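(* Let $f:\mathbb{R}\to\mathbb{R}$ be a locally integrable function (a fixed pointwise representative of an element of $L^1_{\mathrm{loc}}(\mathbb{R})$) and let $x_0\in\mathbb{R}$. If the ordinary Borel derivative $BD_1f(x_0)$ exists finitely, then $T_f'$ has the Łojasiewicz distributional point value $BD_1f(x_0)$ at $x_0$.
   Context: $\mathcal{D}(\mathbb{R})=C_c^\infty(\mathbb{R})$ and $\mathcal{D}'(\mathbb{R})$ is the space of distributions. For $f\in L^1_{\mathrm{loc}}(\mathbb{R})$, $T_f\in\mathcal{D}'(\mathbb{R})$ is the regular distribution $\langle T_f,\psi\rangle=\int_{\mathbb{R}} f\psi\,dx$, and its distributional derivative is $\langle T_f',\psi\rangle=-\langle T_f,\psi'\rangle$. For $\phi\in\mathcal{D}(\mathbb{R})$ and $\varepsilon>0$, $\phi_{x_0,\varepsilon}(x)=\varepsilon^{-1}\phi\left(\frac{x-x_0}{\varepsilon}\right)$. The right and left Borel derivatives of $f$ at $x_0$ are \[ BD_1^+f(x_0)=\lim_{h\to0^+}\frac{1}{h}\int_0^h \frac{f(x_0+t)-f(x_0)}{t}\,dt, \qquad BD_1^-f(x_0)=\lim_{h\to0^+}\frac{1}{h}\int_0^h \frac{f(x_0)-f(x_0-t)}{t}\,dt, \] whenever these limits exist finitely (in particular the integrands are Lebesgue integrable on $(0,h)$ for all sufficiently small $h>0$). If both exist and $BD_1^+f(x_0)=BD_1^-f(x_0)$, the common value is the ordinary Borel derivative $BD_1f(x_0)$. A distribution $T$ has the Łojasiewicz distributional point value $L\in\mathbb{R}$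 at $x_0$ if $\lim_{\varepsilon\to 0^+}\langle T,\phi_{x_0,\varepsilon}\rangle=L\int_{\mathbb{R}}\phi(u)\,du$ for every $\phi\in\mathcal{D}(\mathbb{R})$. *)

theory Defs
  imports "HOL-Analysis.Analysis"
begin

definition locally_integrable :: "(real \<Rightarrow> real) \<Rightarrow> bool" where
  "locally_integrable f \<longleftrightarrow> (\<forall>K. compact K \<longrightarrow> f absolutely_integrable_on K)"


text \<open>The real-valued elements of \<open>C\<^sub>c\<^sup>\<infinity>(\<real>)\<close>. If the iterated derivatives
  are differentiable up to order \<open>k\<close>, then \<open>(deriv ^^ Suc k) \<phi>\<close> is the genuine derivative
  of order \<open>Suc k\<close>, so the junk values of \<^const>\<open>deriv\<close> do not matter.\<close>

definition test_fun :: "(real \<Rightarrow> real) \<Rightarrow> bool" where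
  "test_fun \<phi> \<longleftrightarrow>
     (\<forall>k. (deriv ^^ k) \<phi> differentiable_on UNIV) \<and> compact (closure {x. \<phi> x \<noteq> 0})"

definition test_fun_tendsto :: "(nat \<Rightarrow> real \<Rightarrow> real) \<Rightarrow> (real \<Rightarrow> real) \<Rightarrow> bool" where
  "test_fun_tendsto \<Phi> \<phi> \<longleftrightarrow>
     (\<exists>K. compact K \<and> (\<forall>n. {x. \<Phi> n x \<noteq> 0} \<subseteq> K) \<and> {x. \<phi> x \<noteq> 0} \<subseteq> K) \<and>
     (\<forall>k. uniform_limit UNIV (\<lambda>n. (deriv ^^ k) (\<Phi> n)) ((deriv ^^ k) \<phi>) sequentially)"


text \<open>Distributions are total functions on \<open>real \<Rightarrow> real\<close> of which only the values at test
  functions are relevant. For a linear functional on \<open>C\<^sub>c\<^sup>\<infinity>(\<real>)\<close>, sequential continuity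
  is the same as continuity.\<close>

definition distribution :: "((real \<Rightarrow> real) \<Rightarrow> real) \<Rightarrow> bool" where
  "distribution T \<longleftrightarrow>
     (\<forall>\<phi> \<psi>. test_fun \<phi> \<longrightarrow> test_fun \<psi> \<longrightarrow> T (\<lambda>x. \<phi> x + \<psi> x) = T \<phi> + T \<psi>) \<and>
     (\<forall>c \<phi>. test_fun \<phi> \<longrightarrow> T (\<lambda>x. c * \<phi> x) = c * T \<phi>) \<and>
     (\<forall>\<Phi> \<phi>. (\<forall>n. test_fun (\<Phi> n)) \<longrightarrow> test_fun \<phi> \<longrightarrow> test_fun_tendsto \<Phi> \<phi> \<longrightarrow>
        (\<lambda>n. T (\<Phi> n)) \<longlonglongrightarrow> T \<phi>)"

definition regular_distr :: "(real \<Rightarrow> real) \<Rightarrow> (real \<Rightarrow> real) \<Rightarrow> real" where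
  "regular_distr f \<psi> = (LINT x|lebesgue. f x * \<psi> x)"

definition distr_deriv :: "((real \<Rightarrow> real) \<Rightarrow> real) \<Rightarrow> (real \<Rightarrow> real) \<Rightarrow> real" where
  "distr_deriv T \<psi> = - T (deriv \<psi>)"

definition rescale :: "(real \<Rightarrow> real) \<Rightarrow> real \<Rightarrow> real \<Rightarrow> real \<Rightarrow> real" where
  "rescale \<phi> x0 \<epsilon> = (\<lambda>x. (1 / \<epsilon>) * \<phi> ((x - x0) / \<epsilon>))"

definition has_Lojasiewicz_value :: "((real \<Rightarrow> real) \<Rightarrow> real) \<Rightarrow> real \<Rightarrow> real \<Rightarrow> bool" where
  "has_Lojasiewicz_value T L x0 \<longleftrightarrow> distribution T \<and>
     (\<forall>\<phi>. test_fun \<phi> \<longrightarrow>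
        ((\<lambda>\<epsilon>. T (rescale \<phi> x0 \<epsilon>)) \<longlongrightarrow> L * (LINT u|lebesgue. \<phi> u)) (at_right 0))"


text \<open>The integrability clauses are needed because the Lebesgue integral of a non-integrable
  function is \<open>0\<close> by convention.\<close>

definition has_right_Borel_deriv :: "(real \<Rightarrow> real) \<Rightarrow> real \<Rightarrow> real \<Rightarrow> bool" where
  "has_right_Borel_deriv f D x0 \<longleftrightarrow>
     (\<forall>\<^sub>F h in at_right 0.
        (\<lambda>t. (f (x0 + t) - f x0) / t) absolutely_integrable_on {0<..<h}) \<and>
     ((\<lambda>h. (1 / h) * (LINT t:{0<..<h}|lebesgue. (f (x0 + t) - f x0) / t)) \<longlongrightarrow> D) (at_right 0)"

definition has_left_Borel_deriv :: "(real \<Rightarrow> real) \<Rightarrow> real \<Rightarrow> real \<Rightarrow> bool" where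
  "has_left_Borel_deriv f D x0 \<longleftrightarrow>
     (\<forall>\<^sub>F h in at_right 0.
        (\<lambda>t. (f x0 - f (x0 - t)) / t) absolutely_integrable_on {0<..<h}) \<and>
     ((\<lambda>h. (1 / h) * (LINT t:{0<..<h}|lebesgue. (f x0 - f (x0 - t)) / t)) \<longlongrightarrow> D) (at_right 0)"

definition has_Borel_deriv :: "(real \<Rightarrow> real) \<Rightarrow> real \<Rightarrow> real \<Rightarrow> bool" where
  "has_Borel_deriv f D x0 \<longleftrightarrow> has_right_Borel_deriv f D x0 \<and> has_left_Borel_deriv f D x0"

end

theory Submission
  imports Defs
begin

text \<open>
  Put \<open>g t = (f (x0 + t) - f x0) / t\<close>. Since \<open>\<integral> \<phi>' = 0\<close>, pairing the derivative of \<open>f\<close> with the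
  rescaled test function gives \<open>- \<integral> g (\<epsilon> u) (u \<phi>' u) du\<close>. The Borel derivative says that the
  primitives of \<open>u \<mapsto> g (\<epsilon> u) - D\<close> from \<open>0\<close> tend to \<open>0\<close> uniformly on compact intervals as
  \<open>\<epsilon> \<rightarrow> 0\<close>. The weight \<open>u \<phi>' u\<close> is Lipschitz, hence a difference of monotone functions, so the
  second mean value theorem gives the limit \<open>- D \<integral> u \<phi>' u du = D \<integral> \<phi>\<close>.
\<close>

section \<open>Weighted integrals of rescaled functions\<close>

text \<open>The second mean value theorem writes the weighted integral as \<open>q 0\<close> times
  the integral of \<open>k\<close> over \<open>{0..c}\<close> plus \<open>q R\<close> times its
  integral over \<open>{c..R}\<close>. The latter is a difference of two primitives from 0, whence
  the factor 2. Only primitives of \<open>k\<close> enter the bound, so oscillation of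
  \<open>k\<close> may be exploited.\<close>

lemma abs_integral_mono_weight_le:
  fixes k q :: "real \<Rightarrow> real"
  assumes R: "0 \<le> R" and k: "k integrable_on {0..R}" and mono: "mono_on {0..R} q"
    and bound: "\<And>c. c \<in> {0..R} \<Longrightarrow> \<bar>integral {0..c} k\<bar> \<le> B"
  shows "(\<lambda>x. q x * k x) integrable_on {0..R}"
    and "\<bar>integral {0..R} (\<lambda>x. q x * k x)\<bar> \<le> (\<bar>q 0\<bar> + 2 * \<bar>q R\<bar>) * B"
proof -
  obtain c where c: "c \<in> {0..R}"
    and i: "((\<lambda>x. q x *\<^sub>R k x) has_integral (q 0 *\<^sub>R integral {0..c} k + q R *\<^sub>R integral {c..R} k)) {0..R}"
  proof (rule second_mean_value_theorem_full[OF k R, of q])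
    show "q x \<le> q y" if "0 \<le> x" "x \<le> y" "y \<le> R" for x y
      using mono that by (auto simp: mono_on_def)
  qed simp
  show "(\<lambda>x. q x * k x) integrable_on {0..R}"
    using i by (auto simp: integrable_on_def)
  have "integral {0..c} k + integral {c..R} k = integral {0..R} k"
    using c k by (intro Henstock_Kurzweil_Integration.integral_combine) auto
  then have "\<bar>integral {c..R} k\<bar> \<le> 2 * B"
    using bound[OF c] bound[of R] R by simp
  then have "\<bar>q 0 * integral {0..c} k\<bar> \<le> \<bar>q 0\<bar> * B" "\<bar>q R * integral {c..R} k\<bar> \<le> \<bar>q R\<bar> * (2 * B)"
    using bound[OF c] by (simp_all add: abs_mult mult_left_mono)
  moreover have "integral {0..R} (\<lambda>x. q x * k x) = q 0 * integral {0..c} k + q R * integral {c..R} k"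
    using i by (simp add: integral_unique)
  ultimately show "\<bar>integral {0..R} (\<lambda>x. q x * k x)\<bar> \<le> (\<bar>q 0\<bar> + 2 * \<bar>q R\<bar>) * B"
    by (simp add: algebra_simps)
qed

lemma has_integral_scale_real:
  fixes g :: "real \<Rightarrow> real"
  assumes "0 < e" "(g has_integral I) {0..e * c}"
  shows "((\<lambda>u. g (e * u)) has_integral I / e) {0..c}"
  using has_integral_affinity'[of g I 0 "e * c" e 0] assms
  by (simp add: inverse_eq_divide)

text \<open>After subtracting \<open>D\<close>, the rescaled function has small primitives on all of
  \<open>{0..R}\<close> at once, because a primitive up to \<open>c\<close> only involves the mean
  of \<open>g\<close> over \<open>{0..e * c}\<close>. The bound for monotone weights then applies.
  Integrability is part of the conclusion so that two such integrals can later be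
  subtracted.\<close>

lemma tendsto_integral_rescale_mono:
  fixes g q :: "real \<Rightarrow> real"
  assumes R: "0 < R"
    and int: "\<forall>\<^sub>F h in at_right 0. g integrable_on {0..h}"
    and lim: "((\<lambda>h. integral {0..h} g / h) \<longlongrightarrow> D) (at_right 0)"
    and mono: "mono_on {0..R} q"
  shows "\<forall>\<^sub>F e in at_right 0. (\<lambda>u. q u * g (e * u)) integrable_on {0..R}"
    and "((\<lambda>e. integral {0..R} (\<lambda>u. q u * g (e * u))) \<longlongrightarrow> D * integral {0..R} q) (at_right 0)"
proof -
  \<comment> \<open>\<open>M - 1\<close> is the total factor by which a deviation of the means can
    be amplified; the extra 1 makes \<open>M\<close> positive and the final estimate strict.\<close>
  define M where "M = (\<bar>q 0\<bar> + 2 * \<bar>q R\<bar>) * R + 1"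
  have M: "M > 0" using R unfolding M_def by (intro add_nonneg_pos mult_nonneg_nonneg) auto
  have q: "q integrable_on {0..R}"
    using mono by (rule integrable_on_mono_on)
  have main: "\<forall>\<^sub>F e in at_right 0. (\<lambda>u. q u * g (e * u)) integrable_on {0..R} \<and>
      \<bar>integral {0..R} (\<lambda>u. q u * g (e * u)) - D * integral {0..R} q\<bar> < \<eta>" if \<eta>: "\<eta> > 0" for \<eta>
  proof -
    have "\<forall>\<^sub>F h in at_right 0. \<bar>integral {0..h} g / h - D\<bar> < \<eta> / M"
      using tendstoD[OF lim, of "\<eta> / M"] \<eta> M by (simp add: dist_real_def)
    then have "\<forall>\<^sub>F h in at_right 0. g integrable_on {0..h} \<and> \<bar>integral {0..h} g / h - D\<bar> < \<eta> / M"
      using int by eventually_elim simp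
    then obtain h0 where h0: "h0 > 0" and h0': "\<And>h. 0 < h \<Longrightarrow> h < h0 \<Longrightarrow>
        g integrable_on {0..h} \<and> \<bar>integral {0..h} g / h - D\<bar> < \<eta> / M"
      unfolding eventually_at_right[OF zero_less_one] by blast
    have "(\<lambda>u. q u * g (e * u)) integrable_on {0..R} \<and>
      \<bar>integral {0..R} (\<lambda>u. q u * g (e * u)) - D * integral {0..R} q\<bar> < \<eta>"
      if e: "0 < e" "e < h0 / R" for e
    proof -
      \<comment> \<open>Hence every \<open>e * c\<close> with \<open>c \<le> R\<close> stays below
        \<open>h0\<close>, which gives uniformity in \<open>c\<close>.\<close>
      have eR: "e * R < h0" using e R by (simp add: field_simps)
      have g: "((\<lambda>u. g (e * u)) has_integral integral {0..e * c} g / e) {0..c}" if c: "c \<in> {0<..R}" for c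
      proof -
        have "e * c \<le> e * R" "0 < e * c" using c e by (auto intro: mult_left_mono)
        then have "g integrable_on {0..e * c}" using h0'[of "e * c"] eR by linarith
        then show ?thesis using e by (intro has_integral_scale_real) auto
      qed
      define k where "k u = g (e * u) - D" for u
      have k: "(k has_integral integral {0..e * c} g / e - D * c) {0..c}" if c: "c \<in> {0<..R}" for c
        using has_integral_diff[OF g[OF c] has_integral_const_real[of D 0 c]] c
        by (simp add: k_def[abs_def] mult.commute)
      \<comment> \<open>For positive \<open>c\<close> the primitive is \<open>c\<close> times the
        deviation from \<open>D\<close> of the mean of \<open>g\<close> over
        \<open>{0..e * c}\<close>. This mean is meaningless at \<open>c = 0\<close>, where the
        primitive vanishes anyway.\<close>
      have bound: "\<bar>integral {0..c} k\<bar> \<le> \<eta> / M * R" if c: "c \<in> {0..R}" for c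
      proof (cases "c = 0")
        case True
        then show ?thesis using \<eta> M R by simp
      next
        case False
        then have c': "c \<in> {0<..R}" using c by auto
        have "e * c \<le> e * R" "0 < e * c" using c' e by (auto intro: mult_left_mono)
        then have "\<bar>integral {0..e * c} g / (e * c) - D\<bar> < \<eta> / M" using h0'[of "e * c"] eR by linarith
        moreover have "integral {0..c} k = c * (integral {0..e * c} g / (e * c) - D)"
          using integral_unique[OF k[OF c']] c' by (simp add: field_simps)
        ultimately have "\<bar>integral {0..c} k\<bar> \<le> c * (\<eta> / M)"
          using c' by (simp only: abs_mult) (intro mult_mono; simp)
        also have "\<dots> \<le> R * (\<eta> / M)" using c \<eta> M by (intro mult_right_mono) auto
        finally show ?thesis by (simp add: mult.commute)
      qed
      have k_int: "k integrable_on {0..R}" using k[of R] R by (auto simp: integrable_on_def)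
      note b = abs_integral_mono_weight_le[OF less_imp_le[OF R] k_int mono bound]
      have eq: "q u * g (e * u) = q u * k u + D * q u" for u by (simp add: k_def algebra_simps)
      have "((\<lambda>u. q u * g (e * u)) has_integral integral {0..R} (\<lambda>u. q u * k u) + D * integral {0..R} q) {0..R}"
        unfolding eq using b(1) q by (intro has_integral_add has_integral_mult_right integrable_integral) auto
      moreover have "(\<bar>q 0\<bar> + 2 * \<bar>q R\<bar>) * (\<eta> / M * R) < \<eta>"
      proof -
        have "(\<bar>q 0\<bar> + 2 * \<bar>q R\<bar>) * (\<eta> / M * R) = (M - 1) / M * \<eta>" by (simp add: M_def)
        also have "\<dots> < 1 * \<eta>" using M \<eta> by (intro mult_strict_right_mono) auto
        finally show ?thesis by simp
      qed
      ultimately show ?thesis using b(2) by (auto simp: has_integral_iff)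
    qed
    then show ?thesis
      unfolding eventually_at_right[OF zero_less_one] using h0 R by (intro exI[of _ "h0 / R"]) auto
  qed
  show "\<forall>\<^sub>F e in at_right 0. (\<lambda>u. q u * g (e * u)) integrable_on {0..R}"
    using main[OF zero_less_one] by eventually_elim simp
  show "((\<lambda>e. integral {0..R} (\<lambda>u. q u * g (e * u))) \<longlongrightarrow> D * integral {0..R} q) (at_right 0)"
  proof (rule tendstoI)
    fix \<eta> :: real assume "\<eta> > 0"
    from main[OF this] show "\<forall>\<^sub>F e in at_right 0.
        dist (integral {0..R} (\<lambda>u. q u * g (e * u))) (D * integral {0..R} q) < \<eta>"
      by eventually_elim (simp add: dist_real_def)
  qed
qed

text \<open>Adding \<open>L * u\<close> to an \<open>L\<close>-Lipschitz function makes it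
  nondecreasing, so \<open>q\<close> is the difference of the monotone weights
  \<open>q u + L * u\<close> and \<open>L * u\<close>.\<close>

lemma tendsto_integral_rescale_lipschitz:
  fixes g q :: "real \<Rightarrow> real"
  assumes R: "0 < R"
    and int: "\<forall>\<^sub>F h in at_right 0. g integrable_on {0..h}"
    and lim: "((\<lambda>h. integral {0..h} g / h) \<longlongrightarrow> D) (at_right 0)"
    and lip: "L-lipschitz_on {0..R} q"
  shows "((\<lambda>e. integral {0..R} (\<lambda>u. q u * g (e * u))) \<longlongrightarrow> D * integral {0..R} q) (at_right 0)"
proof -
  have L: "L \<ge> 0" using lip by (rule lipschitz_on_nonneg)
  have 1: "mono_on {0..R} (\<lambda>u. q u + L * u)"
  proof (rule mono_onI)
    fix r s assume *: "r \<in> {0..R}" "s \<in> {0..R}" "r \<le> s"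
    then show "q r + L * r \<le> q s + L * s"
      using lipschitz_onD[OF lip *(1,2)] by (simp add: dist_real_def algebra_simps)
  qed
  have 2: "mono_on {0..R} (\<lambda>u. L * u)"
    using L by (auto intro!: mono_onI mult_left_mono)
  note A = tendsto_integral_rescale_mono[OF R int lim 1]
  note B = tendsto_integral_rescale_mono[OF R int lim 2]
  have q: "(\<lambda>u. q u + L * u) integrable_on {0..R}" "(\<lambda>u. L * u) integrable_on {0..R}"
    using 1 2 by (auto intro!: integrable_on_mono_on)
  have "((\<lambda>e. integral {0..R} (\<lambda>u. (q u + L * u) * g (e * u)) - integral {0..R} (\<lambda>u. L * u * g (e * u)))
      \<longlongrightarrow> D * integral {0..R} (\<lambda>u. q u + L * u) - D * integral {0..R} (\<lambda>u. L * u)) (at_right 0)"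
    by (intro tendsto_diff A B)
  also have "D * integral {0..R} (\<lambda>u. q u + L * u) - D * integral {0..R} (\<lambda>u. L * u) = D * integral {0..R} q"
    unfolding right_diff_distrib[symmetric] Henstock_Kurzweil_Integration.integral_diff[OF q, symmetric]
    by simp
  finally show ?thesis
  proof (rule Lim_transform_eventually)
    \<comment> \<open>Linearity requires both integrals to exist, which is known only for small
      positive \<open>e\<close>.\<close>
    show "\<forall>\<^sub>F e in at_right 0. integral {0..R} (\<lambda>u. (q u + L * u) * g (e * u)) - integral {0..R} (\<lambda>u. L * u * g (e * u))
        = integral {0..R} (\<lambda>u. q u * g (e * u))"
      using A(1) B(1)
    proof eventually_elim
      case (elim e)
      then show ?case
        by (simp add: distrib_right flip: Henstock_Kurzweil_Integration.integral_diff)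
    qed
  qed
qed

section \<open>Test functions, their derivatives and supports\<close>

lemma test_fun_deriv:
  assumes "test_fun p"
  shows "(p has_real_derivative deriv p x) (at x)"
proof -
  have "(deriv ^^ 0) p differentiable_on UNIV" using assms unfolding test_fun_def by blast
  then show ?thesis
    by (simp add: differentiable_on_def DERIV_deriv_iff_real_differentiable)
qed

lemma test_fun_continuous: "test_fun p \<Longrightarrow> continuous_on S p"
  by (meson test_fun_deriv DERIV_isCont continuous_at_imp_continuous_on)

text \<open>Off the closed set \<open>K\<close> the function vanishes on a whole neighbourhood, so
  its derivative is 0 there. With \<open>K\<close> arbitrary, this also covers the common support of
  a convergent sequence.\<close>

lemma support_deriv_subset:
  fixes p :: "real \<Rightarrow> real"
  assumes "{x. p x \<noteq> 0} \<subseteq> K" "closed K"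
  shows "{x. deriv p x \<noteq> 0} \<subseteq> K"
proof -
  have "deriv p x = 0" if "x \<notin> K" for x
  proof -
    have "\<forall>\<^sub>F y in nhds x. y \<in> - K"
      using that assms(2) by (intro eventually_nhds_in_open) auto
    then have "\<forall>\<^sub>F y in nhds x. p y = 0"
      by eventually_elim (use assms(1) in auto)
    then have "deriv p x = deriv (\<lambda>_. 0) x" by (rule deriv_cong_ev) simp
    then show ?thesis by simp
  qed
  then show ?thesis by auto
qed

lemma test_fun_deriv_test_fun:
  assumes "test_fun p"
  shows "test_fun (deriv p)"
proof -
  have "{x. deriv p x \<noteq> 0} \<subseteq> closure {x. p x \<noteq> 0}"
    by (intro support_deriv_subset closure_subset closed_closure)
  then have "closure {x. deriv p x \<noteq> 0} \<subseteq> closure {x. p x \<noteq> 0}"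
    by (rule closure_minimal) simp
  then have "compact (closure {x. deriv p x \<noteq> 0})"
    using assms unfolding test_fun_def by (metis compact_Int_closed closed_closure inf.absorb_iff2)
  moreover have "(deriv ^^ k) (deriv p) differentiable_on UNIV" for k
    using assms unfolding test_fun_def by (metis comp_apply funpow_Suc_right)
  ultimately show ?thesis unfolding test_fun_def by blast
qed

lemma test_fun_bounded_support:
  assumes "test_fun p"
  obtains R where "0 < R" "\<And>x. R \<le> \<bar>x\<bar> \<Longrightarrow> p x = 0" "\<And>x. R \<le> \<bar>x\<bar> \<Longrightarrow> deriv p x = 0"
proof -
  have "bounded (closure {x. p x \<noteq> 0})"
    using assms unfolding test_fun_def by (blast intro: compact_imp_bounded)
  then obtain B where "0 < B" and B: "\<And>x. x \<in> closure {x. p x \<noteq> 0} \<Longrightarrow> \<bar>x\<bar> \<le> B"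
    by (auto simp: bounded_pos)
  have p: "{x. p x \<noteq> 0} \<subseteq> {-B..B}"
    using B closure_subset[of "{x. p x \<noteq> 0}"] by (force simp: abs_le_iff)
  then have "{x. deriv p x \<noteq> 0} \<subseteq> {-B..B}"
    by (rule support_deriv_subset) simp
  \<comment> \<open>The radius exceeds \<open>B\<close> so that \<open>p\<close> and
    \<open>deriv p\<close> vanish at the endpoints too, which removes the boundary terms in the
    integrations by parts.\<close>
  with p \<open>0 < B\<close> show ?thesis by (intro that[of "B + 1"]) force+
qed

section \<open>Regular distributions and distributional derivatives\<close>

text \<open>A continuous \<open>q\<close> is bounded and measurable on \<open>K\<close>, so the
  product stays integrable there. Stated for continuous \<open>q\<close>, it applies to a shifted
  and dilated derivative without checking that this is a test function.\<close>

lemma locally_integrable_mult_integrable: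
  assumes f: "locally_integrable f" and K: "compact K" and q: "continuous_on UNIV q"
    and supp: "{x. q x \<noteq> 0} \<subseteq> K"
  shows "integrable lebesgue (\<lambda>x. f x * q x)"
proof -
  have qK: "continuous_on K q" using q continuous_on_subset by blast
  have "(\<lambda>x. q x * f x) absolutely_integrable_on K"
  proof (rule absolutely_integrable_bounded_measurable_product_real)
    show "K \<in> sets lebesgue" using K by (simp add: lmeasurable_compact fmeasurableD)
    then show "q \<in> borel_measurable (lebesgue_on K)"
      using qK continuous_imp_measurable_on_sets_lebesgue by blast
    show "bounded (q ` K)" using K qK compact_continuous_image compact_imp_bounded by blast
    show "f absolutely_integrable_on K" using f K by (simp add: locally_integrable_def)
  qed
  then have "integrable lebesgue (\<lambda>x. indicator K x *\<^sub>R (q x * f x))" by (simp add: set_integrable_def)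
  moreover have "(\<lambda>x. indicator K x *\<^sub>R (q x * f x)) = (\<lambda>x. f x * q x)"
    using supp by (auto simp: indicator_def fun_eq_iff)
  ultimately show ?thesis by metis
qed

lemma locally_integrable_mult_test_fun:
  assumes "locally_integrable f" "test_fun q"
  shows "integrable lebesgue (\<lambda>x. f x * q x)"
proof (rule locally_integrable_mult_integrable[OF assms(1)])
  show "compact (closure {x. q x \<noteq> 0})" using assms(2) unfolding test_fun_def by blast
qed (use assms(2) in \<open>auto intro: test_fun_continuous closure_subset[THEN subsetD]\<close>)

lemma locally_integrable_const: "locally_integrable (\<lambda>_. c)"
  unfolding locally_integrable_def by (auto intro!: absolutely_integrable_on_const lmeasurable_compact)

text \<open>Sequential continuity is an estimate of order zero: the pairings differ by at most the
  uniform distance of the test functions times the integral of \<open>\<bar>f x\<bar>\<close> over a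
  common compact support.\<close>

lemma distribution_regular_distr:
  assumes f: "locally_integrable f"
  shows "distribution (regular_distr f)"
  unfolding distribution_def
proof (intro conjI allI impI)
  fix p q assume "test_fun p" "test_fun q"
  then show "regular_distr f (\<lambda>x. p x + q x) = regular_distr f p + regular_distr f q"
    using locally_integrable_mult_test_fun[OF f] by (simp add: regular_distr_def distrib_left)
next
  fix c :: real and p
  show "regular_distr f (\<lambda>x. c * p x) = c * regular_distr f p"
    by (simp add: regular_distr_def mult.left_commute[of _ c])
next
  fix P p assume P: "\<forall>n. test_fun (P n)" and p: "test_fun p" and lim: "test_fun_tendsto P p"
  obtain K where K: "compact K" "\<And>n. {x. P n x \<noteq> 0} \<subseteq> K" "{x. p x \<noteq> 0} \<subseteq> K"
    using lim unfolding test_fun_tendsto_def by blast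
  have unif: "uniform_limit UNIV P p sequentially"
    using lim unfolding test_fun_tendsto_def by (metis (no_types, lifting) funpow_0 ext)
  define A where "A = (LINT x:K|lebesgue. \<bar>f x\<bar>)"
  have fK: "f absolutely_integrable_on K" using f K by (simp add: locally_integrable_def)
  have A: "A \<ge> 0" unfolding A_def set_lebesgue_integral_def by (intro integral_nonneg_AE) auto
  have main: "\<forall>\<^sub>F n in sequentially. \<bar>regular_distr f (P n) - regular_distr f p\<bar> \<le> e * A" if "e > 0" for e
    using uniform_limitD[OF unif that]
  proof eventually_elim
    case (elim n)
    have i: "integrable lebesgue (\<lambda>x. f x * P n x)" "integrable lebesgue (\<lambda>x. f x * p x)"
      using P p by (auto intro!: locally_integrable_mult_test_fun[OF f])
    have "\<bar>regular_distr f (P n) - regular_distr f p\<bar> = \<bar>LINT x|lebesgue. f x * P n x - f x * p x\<bar>"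
      using i by (simp add: regular_distr_def)
    also have "\<dots> \<le> (LINT x|lebesgue. \<bar>f x * P n x - f x * p x\<bar>)"
      by (rule integral_abs_bound)
    also have "\<dots> \<le> (LINT x|lebesgue. e * (indicator K x *\<^sub>R \<bar>f x\<bar>))"
    proof (rule integral_mono)
      show "integrable lebesgue (\<lambda>x. \<bar>f x * P n x - f x * p x\<bar>)" using i by simp
      show "integrable lebesgue (\<lambda>x. e * (indicator K x *\<^sub>R \<bar>f x\<bar>))"
        using set_integrable_abs[OF fK] by (simp add: set_integrable_def)
      fix x
      show "\<bar>f x * P n x - f x * p x\<bar> \<le> e * (indicator K x *\<^sub>R \<bar>f x\<bar>)"
      proof (cases "x \<in> K")
        case True
        have "\<bar>P n x - p x\<bar> \<le> e" using elim by (auto simp: dist_real_def less_imp_le)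
        then show ?thesis using True
          by (simp add: mult.commute[of e] abs_mult mult_left_mono flip: right_diff_distrib)
      next
        case False
        then have "P n x = 0" "p x = 0" using K(2)[of n] K(3) by auto
        then show ?thesis using \<open>e > 0\<close> by simp
      qed
    qed
    also have "\<dots> = e * A" by (simp add: A_def set_lebesgue_integral_def)
    finally show ?case .
  qed
  show "(\<lambda>n. regular_distr f (P n)) \<longlonglongrightarrow> regular_distr f p"
  proof (rule tendstoI)
    fix e :: real assume e: "e > 0"
    \<comment> \<open>Dividing by \<open>A + 1\<close> covers the case \<open>A = 0\<close>.\<close>
    have "e / (A + 1) * A < e" using e A by (simp add: field_simps)
    with main[of "e / (A + 1)"] e A
    show "\<forall>\<^sub>F n in sequentially. dist (regular_distr f (P n)) (regular_distr f p) < e"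
      by (auto simp: dist_real_def elim!: eventually_mono)
  qed
qed

text \<open>Convergence of order \<open>k\<close> for the derivatives is convergence of order
  \<open>Suc k\<close> for the functions, and the common compact support is kept.\<close>

lemma test_fun_tendsto_deriv:
  assumes "test_fun_tendsto P p"
  shows "test_fun_tendsto (\<lambda>n. deriv (P n)) (deriv p)"
proof -
  obtain K where K: "compact K" "\<And>n. {x. P n x \<noteq> 0} \<subseteq> K" "{x. p x \<noteq> 0} \<subseteq> K"
    using assms unfolding test_fun_tendsto_def by blast
  then have "{x. deriv (P n) x \<noteq> 0} \<subseteq> K" "{x. deriv p x \<noteq> 0} \<subseteq> K" for n
    by (intro support_deriv_subset compact_imp_closed; blast)+
  moreover have "uniform_limit UNIV (\<lambda>n. (deriv ^^ k) (deriv (P n))) ((deriv ^^ k) (deriv p)) sequentially" for k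
  proof -
    have "uniform_limit UNIV (\<lambda>n. (deriv ^^ Suc k) (P n)) ((deriv ^^ Suc k) p) sequentially"
      using assms unfolding test_fun_tendsto_def by blast
    then show ?thesis by (simp only: funpow_Suc_right comp_apply)
  qed
  ultimately show ?thesis unfolding test_fun_tendsto_def using K(1) by blast
qed

text \<open>The axioms pull back along \<open>deriv\<close>, which is linear and sequentially
  continuous on test functions.\<close>

lemma distribution_distr_deriv:
  assumes "distribution T"
  shows "distribution (distr_deriv T)"
proof -
  have add: "deriv (\<lambda>x. p x + q x) = (\<lambda>x. deriv p x + deriv q x)" if "test_fun p" "test_fun q" for p q
    using that by (intro ext DERIV_imp_deriv DERIV_add test_fun_deriv)
  have cmult: "deriv (\<lambda>x. c * p x) = (\<lambda>x. c * deriv p x)" if "test_fun p" for p c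
    using that by (intro ext DERIV_imp_deriv DERIV_cmult test_fun_deriv)
  show ?thesis
    using assms unfolding distribution_def distr_deriv_def
    by (auto simp: add cmult test_fun_deriv_test_fun test_fun_tendsto_deriv intro!: tendsto_minus)
qed

section \<open>Reduction to integrals over compact intervals\<close>

lemma C1_imp_lipschitz_on_Icc:
  fixes q q' :: "real \<Rightarrow> real"
  assumes "\<And>x. x \<in> {a..b} \<Longrightarrow> (q has_real_derivative q' x) (at x)" "continuous_on {a..b} q'"
  obtains L where "L-lipschitz_on {a..b} q"
proof -
  have "bounded (q' ` {a..b})"
    using assms(2) by (intro compact_imp_bounded compact_continuous_image) auto
  then obtain L where L: "0 < L" "\<And>x. x \<in> {a..b} \<Longrightarrow> \<bar>q' x\<bar> \<le> L"
    by (auto simp: bounded_pos)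
  have "L-lipschitz_on {a..b} q"
  proof (rule bounded_derivative_imp_lipschitz)
    show "(q has_derivative (\<lambda>h. q' x * h)) (at x within {a..b})" if "x \<in> {a..b}" for x
      using assms(1)[OF that] by (simp add: has_field_derivative_def has_derivative_at_withinI)
    show "onorm (\<lambda>h. q' x * h) \<le> L" if "x \<in> {a..b}" for x
      using L(2)[OF that] by (intro onorm_le) (simp add: abs_mult mult_right_mono)
  qed (use L in auto)
  then show ?thesis by (rule that)
qed

text \<open>Translates Borel derivatives from Lebesgue integrals on open intervals to the gauge
  integrals on closed intervals used by the second mean value theorem. The two agree for absolutely
  integrable functions, and endpoints are negligible.\<close>

lemma set_integral_mean_limit:
  fixes g :: "real \<Rightarrow> real"
  assumes "\<forall>\<^sub>F h in at_right 0. g absolutely_integrable_on {0<..<h}"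
    and "((\<lambda>h. (1 / h) * (LINT t:{0<..<h}|lebesgue. g t)) \<longlongrightarrow> D) (at_right 0)"
  shows "\<forall>\<^sub>F h in at_right 0. g integrable_on {0..h}"
    and "((\<lambda>h. integral {0..h} g / h) \<longlongrightarrow> D) (at_right 0)"
proof -
  have *: "g integrable_on {0..h} \<and> (1 / h) * (LINT t:{0<..<h}|lebesgue. g t) = integral {0..h} g / h"
    if "g absolutely_integrable_on {0<..<h}" for h
    using set_lebesgue_integral_eq_integral[OF that]
    by (simp add: integrable_on_open_interval_real integral_open_interval_real)
  show "\<forall>\<^sub>F h in at_right 0. g integrable_on {0..h}"
    using assms(1) by eventually_elim (use * in blast)
  have "\<forall>\<^sub>F h in at_right 0. (1 / h) * (LINT t:{0<..<h}|lebesgue. g t) = integral {0..h} g / h"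
    using assms(1) by eventually_elim (use * in blast)
  from Lim_transform_eventually[OF assms(2) this]
  show "((\<lambda>h. integral {0..h} g / h) \<longlongrightarrow> D) (at_right 0)" .
qed

text \<open>One factor \<open>1 / e\<close> is the normalisation in \<open>rescale\<close>, the
  other comes from the chain rule.\<close>

lemma test_fun_rescale_deriv:
  assumes "test_fun p" "0 < e"
  shows "deriv (rescale p x0 e) x = deriv p ((x - x0) / e) / e\<^sup>2"
  unfolding rescale_def using assms(2)
  by (intro DERIV_imp_deriv)
     (auto intro!: derivative_eq_intros DERIV_chain2[OF test_fun_deriv[OF assms(1)]] simp: power2_eq_square)

text \<open>Folding the line onto \<open>{0..R}\<close> lets the right and left Borel derivatives,
  both expressed through positive increments, be handled by the same limit lemma.\<close>

lemma lebesgue_integral_eq_integral_Icc: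
  fixes F :: "real \<Rightarrow> real"
  assumes F: "integrable lebesgue F" and R: "0 \<le> R" and supp: "\<And>x. R \<le> \<bar>x\<bar> \<Longrightarrow> F x = 0"
  shows "(LINT x|lebesgue. F x) = integral {0..R} F + integral {0..R} (\<lambda>x. F (- x))"
    and "F integrable_on {0..R}" and "(\<lambda>x. F (- x)) integrable_on {0..R}"
proof -
  have eq: "(\<lambda>x. if x \<in> {-R..R} then F x else 0) = F" using supp by (fastforce simp: fun_eq_iff)
  have int: "F integrable_on {-R..R}"
    using integrable_on_lebesgue[OF F] unfolding integrable_restrict_UNIV[of "{-R..R}" F, symmetric] eq .
  then show "F integrable_on {0..R}" using R by (rule_tac integrable_subinterval_real) auto
  have int': "F integrable_on {-R..0}" using int R by (rule_tac integrable_subinterval_real) auto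
  then show "(\<lambda>x. F (- x)) integrable_on {0..R}"
    using Henstock_Kurzweil_Integration.integrable_reflect_real[of F 0 "-R"] by simp
  have "(LINT x|lebesgue. F x) = integral UNIV F" using F by (rule integral_lebesgue[symmetric])
  also have "\<dots> = integral {-R..R} F"
    unfolding Henstock_Kurzweil_Integration.integral_restrict_UNIV[of "{-R..R}" F, symmetric] eq ..
  also have "\<dots> = integral {-R..0} F + integral {0..R} F"
    using R int by (intro Henstock_Kurzweil_Integration.integral_combine[symmetric]) auto
  also have "integral {-R..0} F = integral {0..R} (\<lambda>x. F (- x))"
    using Henstock_Kurzweil_Integration.integral_reflect_real[of R 0 "\<lambda>x. F (- x)"] by simp
  finally show "(LINT x|lebesgue. F x) = integral {0..R} F + integral {0..R} (\<lambda>x. F (- x))" by simp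
qed

lemma test_fun_integrable: "test_fun p \<Longrightarrow> integrable lebesgue p"
  using locally_integrable_mult_test_fun[OF locally_integrable_const[of 1]] by simp

text \<open>The first identity permits subtracting the constant \<open>f x0\<close> from
  \<open>f\<close>; the second is integration by parts, folded onto \<open>{0..R}\<close> to match
  the sum of the two one-sided limits.\<close>

lemma test_fun_integral_deriv:
  assumes p: "test_fun p" and R: "0 < R" "\<And>x. R \<le> \<bar>x\<bar> \<Longrightarrow> p x = 0" "\<And>x. R \<le> \<bar>x\<bar> \<Longrightarrow> deriv p x = 0"
  shows "(LINT x|lebesgue. deriv p x) = 0"
    and "(LINT x|lebesgue. p x) =
      - (integral {0..R} (\<lambda>u. u * deriv p u) + integral {0..R} (\<lambda>u. - (u * deriv p (- u))))"
proof -
  have p': "test_fun (deriv p)" using p by (rule test_fun_deriv_test_fun)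
  note d = test_fun_deriv[OF p] DERIV_chain2[OF test_fun_deriv[OF p]]
  note P = lebesgue_integral_eq_integral_Icc[OF test_fun_integrable[OF p] less_imp_le[OF R(1)] R(2)]
  have R0: "p R = 0" "p (- R) = 0" using R by auto
  have "(deriv p has_integral p R - p 0) {0..R}"
    using R(1)
    by (intro fundamental_theorem_of_calculus)
       (auto simp: has_real_derivative_iff_has_vector_derivative[symmetric] intro: has_field_derivative_at_within d)
  \<comment> \<open>The primitive is \<open>- p (- x)\<close>; its contribution at 0 cancels the one
    from the right half.\<close>
  moreover have "((\<lambda>x. deriv p (- x)) has_integral - p (- R) - (- p (- 0))) {0..R}"
    using R(1)
    by (intro fundamental_theorem_of_calculus)
       (auto simp: has_real_derivative_iff_has_vector_derivative[symmetric] intro!: derivative_eq_intros d)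
  ultimately show "(LINT x|lebesgue. deriv p x) = 0"
    using lebesgue_integral_eq_integral_Icc(1)[OF test_fun_integrable[OF p'] less_imp_le[OF R(1)] R(3)] R0
    by (auto dest!: integral_unique)
  \<comment> \<open>The primitive \<open>x * p x\<close> vanishes at both endpoints. On the
    reflected half, \<open>x * p (- x)\<close> plays the same part.\<close>
  have "((\<lambda>x. p x + x * deriv p x) has_integral R * p R - 0 * p 0) {0..R}"
    using R(1)
    by (intro fundamental_theorem_of_calculus)
       (auto simp: has_real_derivative_iff_has_vector_derivative[symmetric] intro!: derivative_eq_intros d)
  from has_integral_diff[OF this integrable_integral[OF P(2)]]
  have 1: "integral {0..R} (\<lambda>u. u * deriv p u) = - integral {0..R} p"
    using R0 by (simp add: has_integral_iff)
  have "((\<lambda>x. p (- x) - x * deriv p (- x)) has_integral R * p (- R) - 0 * p (- 0)) {0..R}"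
    using R(1)
    by (intro fundamental_theorem_of_calculus)
       (auto simp: has_real_derivative_iff_has_vector_derivative[symmetric] intro!: derivative_eq_intros d)
  from has_integral_diff[OF this integrable_integral[OF P(3)]]
  have 2: "integral {0..R} (\<lambda>u. - (u * deriv p (- u))) = - integral {0..R} (\<lambda>x. p (- x))"
    using R0 by (simp add: has_integral_iff)
  show "(LINT x|lebesgue. p x) =
      - (integral {0..R} (\<lambda>u. u * deriv p u) + integral {0..R} (\<lambda>u. - (u * deriv p (- u))))"
    using P(1) 1 2 by simp
qed

section \<open>The rescaled pairing and its limit\<close>

text \<open>Substituting \<open>x = x0 + e * u\<close> yields a Jacobian \<open>e\<close>, which
  against the \<open>1 / e\<^sup>2\<close> of the differentiated test function leaves
  \<open>1 / e\<close>.\<close>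

lemma regular_distr_deriv_rescale:
  assumes f: "locally_integrable f" and p: "test_fun p" and e: "0 < e"
  shows "integrable lebesgue (\<lambda>u. f (x0 + e * u) * deriv p u)"
    and "distr_deriv (regular_distr f) (rescale p x0 e) = - (LINT u|lebesgue. f (x0 + e * u) * deriv p u) / e"
proof -
  define q where "q x = deriv p ((x - x0) / e)" for x
  have p': "test_fun (deriv p)" using p by (rule test_fun_deriv_test_fun)
  obtain R where R: "0 < R" "\<And>x. R \<le> \<bar>x\<bar> \<Longrightarrow> deriv p x = 0"
    using test_fun_bounded_support[OF p] by metis
  have "integrable lebesgue (\<lambda>x. f x * q x)"
  proof (rule locally_integrable_mult_integrable[OF f])
    show "compact (cball x0 (e * R))" by simp
    show "continuous_on UNIV q"
      unfolding q_def[abs_def] using e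
      by (intro continuous_on_compose2[OF test_fun_continuous[OF p', of UNIV]] continuous_intros) auto
    show "{x. q x \<noteq> 0} \<subseteq> cball x0 (e * R)"
    proof safe
      fix x assume "q x \<noteq> 0"
      then have "\<bar>x - x0\<bar> / e < R" using R(2)[of "(x - x0) / e"] e by (force simp: q_def)
      then show "x \<in> cball x0 (e * R)" using e by (simp add: dist_real_def field_simps abs_minus_commute)
    qed
  qed
  from lebesgue_integrable_real_affine[OF this, of e x0] e
  show "integrable lebesgue (\<lambda>u. f (x0 + e * u) * deriv p u)" by (simp add: q_def)
  have "distr_deriv (regular_distr f) (rescale p x0 e) = - (LINT x|lebesgue. f x * q x / e\<^sup>2)"
    using p e by (simp add: distr_deriv_def regular_distr_def test_fun_rescale_deriv q_def)
  also have "\<dots> = - (LINT x|lebesgue. f x * q x) / e\<^sup>2"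
    by simp
  also have "(LINT x|lebesgue. f x * q x) = e * (LINT u|lebesgue. f (x0 + e * u) * deriv p u)"
    using lebesgue_integral_real_affine[of e "\<lambda>x. f x * q x" x0] e by (simp add: q_def)
  finally show "distr_deriv (regular_distr f) (rescale p x0 e) = - (LINT u|lebesgue. f (x0 + e * u) * deriv p u) / e"
    using e by (simp add: power2_eq_square)
qed

theorem corollary3p12:
  fixes f :: "real \<Rightarrow> real" and x0 D :: real
  assumes "locally_integrable f"
    and "has_Borel_deriv f D x0"
  shows "has_Lojasiewicz_value (distr_deriv (regular_distr f)) D x0"
  unfolding has_Lojasiewicz_value_def
proof (intro conjI allI impI)
  show "distribution (distr_deriv (regular_distr f))"
    using assms(1) by (intro distribution_distr_deriv distribution_regular_distr)
next
  fix p assume p: "test_fun p"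
  obtain R where R: "0 < R" "\<And>x. R \<le> \<bar>x\<bar> \<Longrightarrow> p x = 0" "\<And>x. R \<le> \<bar>x\<bar> \<Longrightarrow> deriv p x = 0"
    using test_fun_bounded_support[OF p] by blast
  note p' = test_fun_deriv_test_fun[OF p]
  note d = DERIV_chain2[OF test_fun_deriv[OF p']]
  define gr gl where "gr t = (f (x0 + t) - f x0) / t" and "gl t = (f x0 - f (x0 - t)) / t" for t
  have gr: "\<forall>\<^sub>F h in at_right 0. gr integrable_on {0..h}"
      "((\<lambda>h. integral {0..h} gr / h) \<longlongrightarrow> D) (at_right 0)"
    and gl: "\<forall>\<^sub>F h in at_right 0. gl integrable_on {0..h}"
      "((\<lambda>h. integral {0..h} gl / h) \<longlongrightarrow> D) (at_right 0)"
    using set_integral_mean_limit[of gr D] set_integral_mean_limit[of gl D] assms(2)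
    unfolding has_Borel_deriv_def has_right_Borel_deriv_def has_left_Borel_deriv_def gr_def gl_def
    by blast+
  \<comment> \<open>The increment of \<open>f\<close> at \<open>e * u\<close> is
    \<open>e * u * gr (e * u)\<close>; its factor \<open>e\<close> cancels the \<open>1 / e\<close>
    of the pairing and its factor \<open>u\<close> joins the weight.\<close>
  obtain Lr where "Lr-lipschitz_on {0..R} (\<lambda>u. u * deriv p u)"
  proof (rule C1_imp_lipschitz_on_Icc)
    show "((\<lambda>u. u * deriv p u) has_real_derivative deriv p u + u * deriv (deriv p) u) (at u)" for u
      by (auto intro!: derivative_eq_intros d)
    show "continuous_on {0..R} (\<lambda>u. deriv p u + u * deriv (deriv p) u)"
      by (intro continuous_intros test_fun_continuous p' test_fun_deriv_test_fun)
  qed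
  note right = tendsto_integral_rescale_lipschitz[OF R(1) gr this]
  \<comment> \<open>On the reflected half the increment is \<open>- (e * u * gl (e * u))\<close>,
    which explains the sign.\<close>
  obtain Ll where "Ll-lipschitz_on {0..R} (\<lambda>u. - (u * deriv p (- u)))"
  proof (rule C1_imp_lipschitz_on_Icc)
    show "((\<lambda>u. - (u * deriv p (- u))) has_real_derivative - deriv p (- u) + u * deriv (deriv p) (- u)) (at u)" for u
      by (auto intro!: derivative_eq_intros d)
    have "continuous_on {0..R} (\<lambda>u. q (- u))" if "test_fun q" for q
      by (rule continuous_on_compose2[OF test_fun_continuous[OF that, of UNIV]]) (auto intro: continuous_intros)
    from this[OF p'] this[OF test_fun_deriv_test_fun[OF p']]
    show "continuous_on {0..R} (\<lambda>u. - deriv p (- u) + u * deriv (deriv p) (- u))"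
      by (intro continuous_intros)
  qed
  note left = tendsto_integral_rescale_lipschitz[OF R(1) gl this]
  define I where "I e = integral {0..R} (\<lambda>u. u * deriv p u * gr (e * u)) +
      integral {0..R} (\<lambda>u. - (u * deriv p (- u)) * gl (e * u))" for e
  have eq: "- I e = distr_deriv (regular_distr f) (rescale p x0 e)" if e: "0 < e" for e
  proof -
    \<comment> \<open>Subtracting \<open>f x0\<close> leaves the integral unchanged since
      \<open>deriv p\<close> has integral 0. At \<open>u = 0\<close> both \<open>F\<close> and the
      weighted quotients are 0, so the identities below hold pointwise everywhere.\<close>
    define F where "F u = (f (x0 + e * u) - f x0) * deriv p u / e" for u
    note resc = regular_distr_deriv_rescale[OF assms(1) p e, of x0]
    have i: "integrable lebesgue (\<lambda>u. f x0 * deriv p u)" using test_fun_integrable[OF p'] by simp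
    have F: "integrable lebesgue F"
      unfolding F_def left_diff_distrib using resc(1) i by simp
    have "(LINT u|lebesgue. F u) = (LINT u|lebesgue. f (x0 + e * u) * deriv p u) / e"
      unfolding F_def left_diff_distrib using resc(1) i test_fun_integral_deriv(1)[OF p R] by simp
    then have "distr_deriv (regular_distr f) (rescale p x0 e) = - (LINT u|lebesgue. F u)"
      using resc(2) by simp
    also have "(LINT u|lebesgue. F u) = integral {0..R} F + integral {0..R} (\<lambda>u. F (- u))"
      using R by (intro lebesgue_integral_eq_integral_Icc F) (auto simp: F_def)
    also have "\<dots> = I e"
    proof -
      have l: "(\<lambda>u. F (- u)) = (\<lambda>u. - (u * deriv p (- u)) * gl (e * u))"
      proof
        show "F (- u) = - (u * deriv p (- u)) * gl (e * u)" for u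
          using e by (cases "u = 0") (simp_all add: F_def gl_def field_simps)
      qed
      have r: "F = (\<lambda>u. u * deriv p u * gr (e * u))"
        using e by (auto simp: F_def gr_def)
      show ?thesis unfolding I_def l[symmetric] r[symmetric] ..
    qed
    finally show ?thesis by simp
  qed
  have "((\<lambda>e. - I e) \<longlongrightarrow> - (D * integral {0..R} (\<lambda>u. u * deriv p u) +
      D * integral {0..R} (\<lambda>u. - (u * deriv p (- u))))) (at_right 0)"
    unfolding I_def by (intro tendsto_minus tendsto_add left right)
  \<comment> \<open>Because both one-sided derivatives equal the same \<open>D\<close>, the two
    halves recombine by the integration by parts identity.\<close>
  also have "- (D * integral {0..R} (\<lambda>u. u * deriv p u) +
      D * integral {0..R} (\<lambda>u. - (u * deriv p (- u)))) = D * (LINT u|lebesgue. p u)"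
    using arg_cong[OF test_fun_integral_deriv(2)[OF p R], of "(*) D"] by (simp add: algebra_simps)
  finally show "((\<lambda>e. distr_deriv (regular_distr f) (rescale p x0 e)) \<longlongrightarrow> D * (LINT u|lebesgue. p u)) (at_right 0)"
    by (rule Lim_transform_eventually) (use eq in \<open>simp add: eventually_at_filter\<close>)
qed

end
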